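(* For $\mu\in P^{+}$ and $\beta\in\Sigma_0^+$ we have $$\frac{2\pi\mu(\beta^\vee)}{\left(1+\frac{h_k}{n}\right)}\leq\widehat{\mu}_k(\beta^\vee)\leq 2\pi\mu(\beta^\vee),$$ where $h_k=2\sum_{\alpha\in\Sigma_0}k_\alpha^{-1}$. Furthermore, for $\mu\in P$, one has $\mu\in P^+$ if and only if $\widehat{\mu}_k\in\overline{V_+^*}$.
   Context: Let $V$ be a Euclidean space of dimension $n$ and $V^*$ the dual Euclidean space, with norm $\|\cdot\|$ and inner product $\langle\cdot,\cdot\rangle$ on $V^*$. Let $\Sigma_0\subset V^*$ be a finite, irreducible, reduced crystallographic root system. The co-root $\alpha^\vee\in V$ of $\alpha\in\Sigma_0$ is determined by $\xi(\alpha^\vee)=2\langle\xi,\alpha\rangle/\|\alpha\|^2$ for all $\xi\in V^*$. Fix a basis of $\Sigma_0$, with positive roots $\Sigma_0^+$. The Weyl group $W_0$ is generated by the reflections $s_\alpha\xi=\xi-\xi(\alpha^\vee)\alpha$ ($\alpha\in\Sigma_0$). The fundamental chamber is $V_+^*=\{\xi\in V^*:\xi(\alpha^\vee)>0\ \forall\alpha\in\Sigma_0^+\}$, with closure $\overline{V_+^*}$. The weight lattice is $P=\{\lambda\in V^*:\lambda(\alpha^\vee)\in\mathbb{Z}\ \forall\alpha\in\Sigma_0\}$, and $P^+$ is the cone of dominant weights, $P^+=\{\lambda\in P:\lambda(\alpha^\vee)\geq0\ \forall\alpha\in\Sigma_0^+\}$. The multiplicity function restricted to $\Sigma_0$ is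 a $W_0$-invariant function $\alpha\mapsto k_\alpha\in\mathbb{R}_{>0}$. (In the paper $k$ is a strictly positive function on the affine root system $\Sigma=\Sigma_0+\mathbb{Z}$, invariant under the affine Weyl group, with $k(a)=k(Da)$, $Da\in\Sigma_0$ the gradient of $a$; only the values on $\Sigma_0$ matter here.) The master function $S_k:P\times V^*\to\mathbb{R}$ is $$S_k(\mu,\xi)=\frac12\|\xi\|^2-2\pi\langle\mu,\xi\rangle+\frac12\sum_{\alpha\in\Sigma_0}\|\alpha\|^2\int_0^{\xi(\alpha^\vee)}\arctan\left(\frac{t}{k_\alpha}\right)dt.$$ For $\mu\in P$, $\widehat{\mu}_k\in V^*$ denotes the unique extremum (the unique point where all directional derivatives vanish) of the strictly convex function $S_k(\mu,\cdot)$ on $V^*$. *)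

theory Defs
  imports "HOL-Analysis.Analysis"
begin

text \<open>
  The type \<open>'a\<close> is the dual space \<open>V\<^sup>*\<close> with its inner product, so \<open>n\<close> is \<open>DIM('a)\<close>.
  The space \<open>V\<close> only enters through the co-roots.  They are given as linear functionals on
  \<open>V\<^sup>*\<close>, i.e. through \<open>V = V\<^sup>*\<^sup>*\<close>, so that \<open>coroot \<alpha> \<xi>\<close> is the number \<open>\<xi>(\<alpha>\<^sup>\<or>)\<close>.
\<close>

definition coroot :: "'a::euclidean_space \<Rightarrow> 'a \<Rightarrow> real" where
  "coroot \<alpha> \<xi> = 2 * (\<xi> \<bullet> \<alpha>) / (norm \<alpha>)\<^sup>2"

definition reflection :: "'a::euclidean_space \<Rightarrow> 'a \<Rightarrow> 'a" where
  "reflection \<alpha> \<xi> = \<xi> - coroot \<alpha> \<xi> *\<^sub>R \<alpha>"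

definition root_system :: "'a::euclidean_space set \<Rightarrow> bool" where
  "root_system R \<longleftrightarrow> finite R \<and> 0 \<notin> R \<and> span R = UNIV \<and> (\<forall>\<alpha>\<in>R. reflection \<alpha> ` R = R)"

definition crystallographic :: "'a::euclidean_space set \<Rightarrow> bool" where
  "crystallographic R \<longleftrightarrow> (\<forall>\<alpha>\<in>R. \<forall>\<beta>\<in>R. coroot \<alpha> \<beta> \<in> \<int>)"

definition reduced_roots :: "'a::euclidean_space set \<Rightarrow> bool" where
  "reduced_roots R \<longleftrightarrow> (\<forall>\<alpha>\<in>R. \<forall>c. c *\<^sub>R \<alpha> \<in> R \<longrightarrow> c = 1 \<or> c = - 1)"

definition irreducible_roots :: "'a::euclidean_space set \<Rightarrow> bool" where
  "irreducible_roots R \<longleftrightarrow> R \<noteq> {} \<and>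
     \<not> (\<exists>A B. A \<noteq> {} \<and> B \<noteq> {} \<and> A \<inter> B = {} \<and> A \<union> B = R \<and> (\<forall>\<alpha>\<in>A. \<forall>\<beta>\<in>B. \<alpha> \<bullet> \<beta> = 0))"

definition root_basis :: "'a::euclidean_space set \<Rightarrow> 'a set \<Rightarrow> bool" where
  "root_basis R \<Delta> \<longleftrightarrow> \<Delta> \<subseteq> R \<and> independent \<Delta> \<and> span \<Delta> = UNIV \<and>
     (\<forall>\<beta>\<in>R. \<exists>c :: 'a \<Rightarrow> int. \<beta> = (\<Sum>\<alpha>\<in>\<Delta>. of_int (c \<alpha>) *\<^sub>R \<alpha>) \<and>
        ((\<forall>\<alpha>\<in>\<Delta>. 0 \<le> c \<alpha>) \<or> (\<forall>\<alpha>\<in>\<Delta>. c \<alpha> \<le> 0)))"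

definition positive_roots :: "'a::euclidean_space set \<Rightarrow> 'a set \<Rightarrow> 'a set" where
  "positive_roots R \<Delta> = {\<beta>\<in>R. \<exists>c :: 'a \<Rightarrow> nat. \<beta> = (\<Sum>\<alpha>\<in>\<Delta>. of_nat (c \<alpha>) *\<^sub>R \<alpha>)}"

text \<open>The generators are involutions, so no closure under inverses has to be demanded.\<close>

inductive_set weyl_group :: "('a::euclidean_space) set \<Rightarrow> ('a \<Rightarrow> 'a) set"
  for R :: "'a set" where
  one: "id \<in> weyl_group R"
| refl: "\<alpha> \<in> R \<Longrightarrow> w \<in> weyl_group R \<Longrightarrow> reflection \<alpha> \<circ> w \<in> weyl_group R"

definition fundamental_chamber :: "'a::euclidean_space set \<Rightarrow> 'a set \<Rightarrow> 'a set" where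
  "fundamental_chamber R \<Delta> = {\<xi>. \<forall>\<alpha>\<in>positive_roots R \<Delta>. coroot \<alpha> \<xi> > 0}"

definition weight_lattice :: "'a::euclidean_space set \<Rightarrow> 'a set" where
  "weight_lattice R = {\<mu>. \<forall>\<alpha>\<in>R. coroot \<alpha> \<mu> \<in> \<int>}"

definition dominant_weights :: "'a::euclidean_space set \<Rightarrow> 'a set \<Rightarrow> 'a set" where
  "dominant_weights R \<Delta> = {\<mu>\<in>weight_lattice R. \<forall>\<alpha>\<in>positive_roots R \<Delta>. coroot \<alpha> \<mu> \<ge> 0}"

text \<open>Only the values of \<open>k\<close> on \<open>R\<close> are relevant.\<close>

definition multiplicity_function :: "'a::euclidean_space set \<Rightarrow> ('a \<Rightarrow> real) \<Rightarrow> bool" where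
  "multiplicity_function R k \<longleftrightarrow>
     (\<forall>\<alpha>\<in>R. k \<alpha> > 0) \<and> (\<forall>w\<in>weyl_group R. \<forall>\<alpha>\<in>R. k (w \<alpha>) = k \<alpha>)"

text \<open>The interval integral is oriented, as required when \<open>coroot \<alpha> \<xi>\<close> is negative.\<close>

definition master_function ::
    "'a::euclidean_space set \<Rightarrow> ('a \<Rightarrow> real) \<Rightarrow> 'a \<Rightarrow> 'a \<Rightarrow> real" where
  "master_function R k \<mu> \<xi> =
     1 / 2 * (norm \<xi>)\<^sup>2 - 2 * pi * (\<mu> \<bullet> \<xi>) +
     1 / 2 * (\<Sum>\<alpha>\<in>R. (norm \<alpha>)\<^sup>2 * (LBINT t = ereal 0..ereal (coroot \<alpha> \<xi>). arctan (t / k \<alpha>)))"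

definition master_extremum ::
    "'a::euclidean_space set \<Rightarrow> ('a \<Rightarrow> real) \<Rightarrow> 'a \<Rightarrow> 'a" where
  "master_extremum R k \<mu> =
     (THE \<xi>. \<forall>v. ((\<lambda>t. master_function R k \<mu> (\<xi> + t *\<^sub>R v)) has_real_derivative 0) (at 0))"

definition h_const :: "'a::euclidean_space set \<Rightarrow> ('a \<Rightarrow> real) \<Rightarrow> real" where
  "h_const R k = 2 * (\<Sum>\<alpha>\<in>R. inverse (k \<alpha>))"

end

theory Submission
  imports Defs
begin

text \<open>
  The extremum \<open>\<xi>\<close> solves \<open>\<xi> + \<rho>(\<xi>) = 2\<pi>\<mu>\<close> where \<open>\<rho>\<close> is \<open>root_drift\<close>,
  \<open>\<rho>(\<xi>) = \<Sum>\<^sub>\<alpha> arctan (\<xi>(\<alpha>\<^sup>\<or>) / k\<^sub>\<alpha>) \<alpha>\<close>; since \<open>\<rho>\<close> is continuous, bounded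
  and monotone, a solution exists by Brouwer's theorem and is unique.  Pairing \<open>\<alpha>\<close> with its
  mirror image under \<open>s\<^sub>\<beta>\<close> in the sum for \<open>\<rho>(\<xi>)(\<beta>\<^sup>\<or>)\<close> and using that \<open>arctan\<close> is
  increasing and 1-Lipschitz bounds \<open>\<rho>(\<xi>)(\<beta>\<^sup>\<or>)\<close> between \<open>0\<close> and
  \<open>2 \<xi>(\<beta>\<^sup>\<or>) \<Sum>\<^sub>\<alpha> \<langle>\<alpha>,\<beta>\<rangle>\<^sup>2 / (k\<^sub>\<alpha> \<parallel>\<alpha>\<parallel>\<^sup>2 \<parallel>\<beta>\<parallel>\<^sup>2)\<close> whenever
  \<open>\<xi>(\<beta>\<^sup>\<or>) \<ge> 0\<close>.  By Schur's lemma the invariant quadratic form in the last sum is a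
  multiple of the norm squared, and its trace identifies the bound as \<open>(h\<^sub>k / n) \<xi>(\<beta>\<^sup>\<or>)\<close>.
\<close>

section \<open>Co-roots, reflections and their action on the roots\<close>

lemma coroot_linear: "linear (coroot \<alpha>)"
  unfolding coroot_def
  by (rule linearI) (auto simp: inner_add_left add_divide_distrib ring_distribs)

lemmas coroot_add = linear_add[OF coroot_linear]
  and coroot_diff = linear_diff[OF coroot_linear]
  and coroot_scale = linear_scale[OF coroot_linear]
  and coroot_sum = linear_sum[OF coroot_linear]

lemma continuous_on_coroot [continuous_intros]:
  "continuous_on S f \<Longrightarrow> continuous_on S (\<lambda>x. coroot \<alpha> (f x))"
  unfolding coroot_def by (cases "\<alpha> = 0") (auto intro!: continuous_intros)

lemma coroot_minus_root: "coroot (- \<alpha>) \<xi> = - coroot \<alpha> \<xi>"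
  by (simp add: coroot_def)

lemma reflection_self: "\<alpha> \<noteq> 0 \<Longrightarrow> reflection \<alpha> \<alpha> = - \<alpha>"
  by (simp add: reflection_def coroot_def power2_norm_eq_inner scaleR_2)

lemma reflection_linear: "linear (reflection \<alpha>)"
  unfolding reflection_def
  by (rule linearI) (simp_all add: coroot_add coroot_scale algebra_simps)

lemma reflection_inner: "reflection \<beta> x \<bullet> y = x \<bullet> reflection \<beta> y"
  by (simp add: reflection_def coroot_def inner_diff_left inner_diff_right inner_commute)

lemma reflection_reflection: "\<beta> \<noteq> 0 \<Longrightarrow> reflection \<beta> (reflection \<beta> x) = x"
  by (simp add: reflection_def coroot_diff coroot_scale)
     (simp add: coroot_def power2_norm_eq_inner)

lemma norm_reflection: "\<beta> \<noteq> 0 \<Longrightarrow> norm (reflection \<beta> x) = norm x"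
  by (simp add: norm_eq_sqrt_inner reflection_inner reflection_reflection)

text \<open>A reflection is a self-adjoint isometry, so it can be moved from the root to the
  argument.\<close>

lemma coroot_reflection_root:
  "\<beta> \<noteq> 0 \<Longrightarrow> coroot (reflection \<beta> \<alpha>) \<xi> = coroot \<alpha> (reflection \<beta> \<xi>)"
  by (simp add: coroot_def norm_reflection reflection_inner)

lemma coroot_reflection: "\<beta> \<noteq> 0 \<Longrightarrow> coroot \<beta> (reflection \<beta> \<xi>) = - coroot \<beta> \<xi>"
  by (simp add: reflection_self coroot_minus_root flip: coroot_reflection_root)

text \<open>Reflections permute the roots. Both symmetry arguments below, the invariance of a
  quadratic form and the pairing of \<alpha> with its mirror image, are this change of summation
  index.\<close>

lemma sum_reflection:
  assumes "root_system R" "\<beta> \<in> R"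
  shows "(\<Sum>\<alpha>\<in>R. f (reflection \<beta> \<alpha>)) = (\<Sum>\<alpha>\<in>R. f \<alpha>)"
proof (rule sum.reindex_bij_betw)
  have "\<beta> \<noteq> 0" using assms by (auto simp: root_system_def)
  then have "inj_on (reflection \<beta>) R"
    by (metis inj_onI reflection_reflection)
  then show "bij_betw (reflection \<beta>) R R"
    using assms by (auto simp: bij_betw_def root_system_def)
qed

lemma uminus_root:
  assumes "root_system R" "\<beta> \<in> R"
  shows "- \<beta> \<in> R"
  using assms reflection_self[of \<beta>] unfolding root_system_def by (metis imageI)

lemma multiplicity_reflection:
  assumes "multiplicity_function R k" "\<beta> \<in> R" "\<alpha> \<in> R"
  shows "k (reflection \<beta> \<alpha>) = k \<alpha>"
  using assms weyl_group.refl[OF \<open>\<beta> \<in> R\<close> weyl_group.one]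
  unfolding multiplicity_function_def by fastforce

section \<open>Calculus of arctan and its oriented integral\<close>

text \<open>The function t - arctan t is nondecreasing, its derivative being 1 - 1 / (1 +
  t^2).\<close>

lemma arctan_diff_le:
  fixes x y :: real
  assumes "x \<le> y"
  shows "arctan y - arctan x \<le> y - x"
proof -
  have "\<exists>d. ((\<lambda>t. t - arctan t) has_real_derivative d) (at t) \<and> 0 \<le> d" for t :: real
    by (rule exI[of _ "1 - inverse (1 + t\<^sup>2)"])
       (auto intro!: derivative_eq_intros simp: inverse_le_1_iff)
  then have "x - arctan x \<le> y - arctan y"
    by (intro DERIV_nonneg_imp_nondecreasing[OF assms]) blast
  then show ?thesis by simp
qed

lemma arctan_antiderivative:
  fixes k x :: real
  assumes "k > 0"
  shows "((\<lambda>x. k * (x / k * arctan (x / k) - ln (1 + (x / k)\<^sup>2) / 2)) has_real_derivative arctan (x / k)) (at x)"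
proof -
  have "((\<lambda>u. u * arctan u - ln (1 + u\<^sup>2) / 2) has_real_derivative arctan u) (at u)" for u :: real
  proof -
    have "1 + u\<^sup>2 > 0" by (simp add: add_pos_nonneg)
    moreover have "((\<lambda>u. 1 + u\<^sup>2) has_real_derivative 2 * u) (at u)"
      by (auto intro!: derivative_eq_intros)
    ultimately have "((\<lambda>u. ln (1 + u\<^sup>2)) has_real_derivative 1 / (1 + u\<^sup>2) * (2 * u)) (at u)"
      by (intro DERIV_chain2[OF DERIV_ln_divide])
    then have "((\<lambda>u. ln (1 + u\<^sup>2) / 2) has_real_derivative 1 / (1 + u\<^sup>2) * (2 * u) / 2) (at u)"
      by (rule DERIV_cdivide)
    moreover have "1 / y * (2 * u) / 2 = inverse y * u" for y
      by (simp add: inverse_eq_divide)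
    ultimately have "((\<lambda>u. ln (1 + u\<^sup>2) / 2) has_real_derivative inverse (1 + u\<^sup>2) * u) (at u)"
      by metis
    from DERIV_diff[OF DERIV_mult[OF DERIV_ident DERIV_arctan] this]
    show ?thesis by simp
  qed
  moreover have "((\<lambda>x. x / k) has_real_derivative 1 / k) (at x)"
    by (rule DERIV_cdivide[OF DERIV_ident])
  ultimately have "((\<lambda>x. x / k * arctan (x / k) - ln (1 + (x / k)\<^sup>2) / 2) has_real_derivative
      arctan (x / k) * (1 / k)) (at x)"
    by (rule DERIV_chain2)
  from DERIV_cmult[OF this, of k] show ?thesis using assms by simp
qed

text \<open>With an explicit primitive on the whole line, the fundamental theorem covers upper
  limits of either sign at once.\<close>

lemma has_derivative_integral_arctan:
  fixes k :: real
  assumes "k > 0"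
  shows "((\<lambda>x. LBINT t = ereal 0..ereal x. arctan (t / k)) has_real_derivative arctan (x / k)) (at x)"
proof -
  define F where "F x = k * (x / k * arctan (x / k) - ln (1 + (x / k)\<^sup>2) / 2)" for x
  have F: "(F has_real_derivative arctan (x / k)) (at x)" for x
    using arctan_antiderivative[OF assms] unfolding F_def .
  have "(LBINT t = ereal 0..ereal x. arctan (t / k)) = F x - F 0" for x
  proof (rule interval_integral_FTC_finite)
    show "continuous_on {min 0 x..max 0 x} (\<lambda>t. arctan (t / k))"
      using assms by (intro continuous_intros) auto
    show "(F has_vector_derivative arctan (t / k)) (at t within {min 0 x..max 0 x})" for t
      using F has_field_derivative_at_within has_real_derivative_iff_has_vector_derivative by blast
  qed
  with DERIV_diff[OF F DERIV_const[of "F 0"]] show ?thesis by simp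
qed

section \<open>The gradient of the master function and its unique zero\<close>

text \<open>This is the gradient of the integral part of \<open>master_function\<close>: the chain
  rule contributes \<open>coroot \<alpha> v\<close>, whose denominator cancels the weight
  \<open>(norm \<alpha>)\<^sup>2\<close>, and the remaining factor 2 cancels the 1 / 2 in front of
  the sum.\<close>

definition root_drift :: "'a::euclidean_space set \<Rightarrow> ('a \<Rightarrow> real) \<Rightarrow> 'a \<Rightarrow> 'a" where
  "root_drift R k \<xi> = (\<Sum>\<alpha>\<in>R. arctan (coroot \<alpha> \<xi> / k \<alpha>) *\<^sub>R \<alpha>)"

lemma master_function_derivative:
  assumes R: "root_system R" and k: "\<And>\<alpha>. \<alpha> \<in> R \<Longrightarrow> k \<alpha> > 0"
  shows "((\<lambda>t. master_function R k \<mu> (\<xi> + t *\<^sub>R v)) has_real_derivative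
           (\<xi> + root_drift R k \<xi> - (2 * pi) *\<^sub>R \<mu>) \<bullet> v) (at 0)"
proof -
  define I where "I \<alpha> x = (LBINT t = ereal 0..ereal x. arctan (t / k \<alpha>))" for \<alpha> x
  have I: "((\<lambda>t. (norm \<alpha>)\<^sup>2 * I \<alpha> (coroot \<alpha> (\<xi> + t *\<^sub>R v))) has_real_derivative
             2 * arctan (coroot \<alpha> \<xi> / k \<alpha>) * (\<alpha> \<bullet> v)) (at 0)" if "\<alpha> \<in> R" for \<alpha>
  proof -
    have nz: "norm \<alpha> \<noteq> 0" using that R by (auto simp: root_system_def)
    have 1: "((\<lambda>t. coroot \<alpha> (\<xi> + t *\<^sub>R v)) has_real_derivative coroot \<alpha> v) (at 0)"
      unfolding coroot_add coroot_scale by (auto intro!: derivative_eq_intros)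
    have 2: "(I \<alpha> has_real_derivative arctan (coroot \<alpha> \<xi> / k \<alpha>)) (at (coroot \<alpha> (\<xi> + 0 *\<^sub>R v)))"
      unfolding I_def using has_derivative_integral_arctan[OF k[OF that]] by simp
    have "((\<lambda>t. (norm \<alpha>)\<^sup>2 * I \<alpha> (coroot \<alpha> (\<xi> + t *\<^sub>R v))) has_real_derivative
             (norm \<alpha>)\<^sup>2 * (arctan (coroot \<alpha> \<xi> / k \<alpha>) * coroot \<alpha> v)) (at 0)"
      by (rule DERIV_cmult DERIV_chain2[OF 2 1])+
    moreover have "(norm \<alpha>)\<^sup>2 * (arctan (coroot \<alpha> \<xi> / k \<alpha>) * coroot \<alpha> v)
       = 2 * arctan (coroot \<alpha> \<xi> / k \<alpha>) * (\<alpha> \<bullet> v)"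
      using nz by (simp add: coroot_def[of \<alpha> v] inner_commute)
    ultimately show ?thesis by simp
  qed
  have "((\<lambda>t. 1 / 2 * (norm (\<xi> + t *\<^sub>R v))\<^sup>2 - 2 * pi * (\<mu> \<bullet> (\<xi> + t *\<^sub>R v)) +
          1 / 2 * (\<Sum>\<alpha>\<in>R. (norm \<alpha>)\<^sup>2 * I \<alpha> (coroot \<alpha> (\<xi> + t *\<^sub>R v)))) has_real_derivative
        \<xi> \<bullet> v - 2 * pi * (\<mu> \<bullet> v) + 1 / 2 * (\<Sum>\<alpha>\<in>R. 2 * arctan (coroot \<alpha> \<xi> / k \<alpha>) * (\<alpha> \<bullet> v))) (at 0)"
  proof (intro DERIV_add DERIV_diff DERIV_cmult DERIV_sum I)
    have *: "(norm (\<xi> + t *\<^sub>R v))\<^sup>2 = \<xi> \<bullet> \<xi> + 2 * t * (\<xi> \<bullet> v) + t\<^sup>2 * (v \<bullet> v)" for t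
      unfolding power2_norm_eq_inner
      by (simp add: inner_add_left inner_add_right inner_commute power2_eq_square algebra_simps)
    have "((\<lambda>t. (norm (\<xi> + t *\<^sub>R v))\<^sup>2) has_real_derivative 2 * (\<xi> \<bullet> v)) (at 0)"
      unfolding * by (auto intro!: derivative_eq_intros)
    from DERIV_cmult[OF this, of "1 / 2"]
    show "((\<lambda>t. 1 / 2 * (norm (\<xi> + t *\<^sub>R v))\<^sup>2) has_real_derivative \<xi> \<bullet> v) (at 0)" by simp
    show "((\<lambda>t. \<mu> \<bullet> (\<xi> + t *\<^sub>R v)) has_real_derivative \<mu> \<bullet> v) (at 0)"
      unfolding inner_add_right inner_scaleR_right by (auto intro!: derivative_eq_intros)
  qed
  moreover have "\<xi> \<bullet> v - 2 * pi * (\<mu> \<bullet> v) + 1 / 2 * (\<Sum>\<alpha>\<in>R. 2 * arctan (coroot \<alpha> \<xi> / k \<alpha>) * (\<alpha> \<bullet> v))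
      = (\<xi> + root_drift R k \<xi> - (2 * pi) *\<^sub>R \<mu>) \<bullet> v"
    by (simp add: root_drift_def inner_add_left inner_diff_left inner_sum_left sum_distrib_left mult.assoc)
  ultimately show ?thesis
    by (simp add: master_function_def I_def)
qed

text \<open>Solutions are the fixed points of \<xi> \<mapsto> c - \<open>root_drift R k\<close>
  \<xi>, a continuous map with bounded image, which therefore sends a large ball into
  itself.\<close>

lemma root_drift_fixed_point:
  assumes "finite R"
  shows "\<exists>\<xi>. \<xi> + root_drift R k \<xi> = c"
proof -
  \<comment> \<open>Each arctan is at most pi / 2 in absolute value. The summand 1 keeps the radius
    positive even when the other two vanish.\<close>
  define M where "M = norm c + (\<Sum>\<alpha>\<in>R. pi / 2 * norm \<alpha>) + 1"
  have M: "norm (c - root_drift R k \<xi>) \<le> M" for \<xi>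
  proof -
    have "norm (root_drift R k \<xi>) \<le> (\<Sum>\<alpha>\<in>R. pi / 2 * norm \<alpha>)"
      unfolding root_drift_def
    proof (rule sum_norm_le)
      fix \<alpha>
      have "\<bar>arctan (coroot \<alpha> \<xi> / k \<alpha>)\<bar> \<le> pi / 2"
        using arctan_bounded[of "coroot \<alpha> \<xi> / k \<alpha>"] by linarith
      then show "norm (arctan (coroot \<alpha> \<xi> / k \<alpha>) *\<^sub>R \<alpha>) \<le> pi / 2 * norm \<alpha>"
        using mult_right_mono[of "\<bar>arctan (coroot \<alpha> \<xi> / k \<alpha>)\<bar>" "pi / 2" "norm \<alpha>"] by simp
    qed
    then show ?thesis
      unfolding M_def using norm_triangle_ineq4[of c "root_drift R k \<xi>"] by linarith
  qed
  have "M > 0" unfolding M_def by (intro add_nonneg_pos add_nonneg_nonneg sum_nonneg) auto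
  moreover have "continuous_on (cball 0 M) (\<lambda>\<xi>. c - root_drift R k \<xi>)"
    \<comment> \<open>Division by \<open>k \<alpha>\<close> becomes multiplication by a constant, so
      continuity raises no question of a zero denominator.\<close>
    unfolding root_drift_def divide_inverse by (auto intro!: continuous_intros)
  ultimately obtain \<xi> where "c - root_drift R k \<xi> = \<xi>"
    using M by (elim brouwer_ball[of M 0 "\<lambda>\<xi>. c - root_drift R k \<xi>"]) auto
  then show ?thesis by (metis diff_add_cancel)
qed

text \<open>Monotonicity holds root by root: the increment of arctan and \<alpha> \<bullet> (\<xi> -
  \<eta>) both have the sign of the difference of the co-root values.\<close>

lemma root_drift_monotone:
  assumes R: "root_system R" and k: "\<And>\<alpha>. \<alpha> \<in> R \<Longrightarrow> k \<alpha> > 0"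
  shows "0 \<le> (root_drift R k \<xi> - root_drift R k \<eta>) \<bullet> (\<xi> - \<eta>)"
proof -
  have "0 \<le> (arctan (coroot \<alpha> \<xi> / k \<alpha>) - arctan (coroot \<alpha> \<eta> / k \<alpha>)) * (\<alpha> \<bullet> (\<xi> - \<eta>))"
    if "\<alpha> \<in> R" for \<alpha>
  proof -
    have "\<alpha> \<noteq> 0" using that R by (auto simp: root_system_def)
    then have *: "\<alpha> \<bullet> (\<xi> - \<eta>) = (norm \<alpha>)\<^sup>2 / 2 * (coroot \<alpha> \<xi> - coroot \<alpha> \<eta>)"
      by (simp add: inner_commute inner_diff_right field_simps coroot_def)
    have "0 \<le> (arctan (coroot \<alpha> \<xi> / k \<alpha>) - arctan (coroot \<alpha> \<eta> / k \<alpha>)) * (coroot \<alpha> \<xi> - coroot \<alpha> \<eta>)"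
      using k[OF that]
      by (cases "coroot \<alpha> \<xi>" "coroot \<alpha> \<eta>" rule: le_cases)
         (simp_all add: mult_nonneg_nonneg mult_nonpos_nonpos arctan_le_iff divide_right_mono)
    then have "0 \<le> (norm \<alpha>)\<^sup>2 / 2 *
       ((arctan (coroot \<alpha> \<xi> / k \<alpha>) - arctan (coroot \<alpha> \<eta> / k \<alpha>)) * (coroot \<alpha> \<xi> - coroot \<alpha> \<eta>))"
      by (rule mult_nonneg_nonneg[rotated]) simp
    then show ?thesis unfolding * by (simp add: mult_ac)
  qed
  then have "0 \<le> (\<Sum>\<alpha>\<in>R. (arctan (coroot \<alpha> \<xi> / k \<alpha>) - arctan (coroot \<alpha> \<eta> / k \<alpha>)) * (\<alpha> \<bullet> (\<xi> - \<eta>)))"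
    by (rule sum_nonneg)
  also have "\<dots> = (root_drift R k \<xi> - root_drift R k \<eta>) \<bullet> (\<xi> - \<eta>)"
    by (simp add: root_drift_def inner_sum_left inner_diff_left left_diff_distrib sum_subtractf)
  finally show ?thesis .
qed

text \<open>The critical points are exactly the solutions of this equation. Since there is one and
  only one, the definite description in \<open>master_extremum\<close> denotes it.\<close>

lemma master_extremum_eq:
  assumes R: "root_system R" and k: "\<And>\<alpha>. \<alpha> \<in> R \<Longrightarrow> k \<alpha> > 0"
  shows "master_extremum R k \<mu> + root_drift R k (master_extremum R k \<mu>) = (2 * pi) *\<^sub>R \<mu>"
proof -
  have critical: "(\<forall>v. ((\<lambda>t. master_function R k \<mu> (\<xi> + t *\<^sub>R v)) has_real_derivative 0) (at 0))
      \<longleftrightarrow> \<xi> + root_drift R k \<xi> = (2 * pi) *\<^sub>R \<mu>" (is "?C \<longleftrightarrow> ?E") for \<xi>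
  proof
    assume ?C
    then have "(\<xi> + root_drift R k \<xi> - (2 * pi) *\<^sub>R \<mu>) \<bullet> v = 0" for v
      using DERIV_unique master_function_derivative[where R = R and k = k, OF R k] by blast
    then show ?E by (metis eq_iff_diff_eq_0 inner_eq_zero_iff)
  next
    assume ?E
    then show ?C using master_function_derivative[where R = R and k = k, OF R k, of \<mu> \<xi>] by simp
  qed
  have "\<exists>!\<xi>. \<xi> + root_drift R k \<xi> = (2 * pi) *\<^sub>R \<mu>"
  proof (rule ex_ex1I)
    show "\<exists>\<xi>. \<xi> + root_drift R k \<xi> = (2 * pi) *\<^sub>R \<mu>"
      using R by (intro root_drift_fixed_point) (simp add: root_system_def)
    fix \<xi> \<eta>
    assume "\<xi> + root_drift R k \<xi> = (2 * pi) *\<^sub>R \<mu>" "\<eta> + root_drift R k \<eta> = (2 * pi) *\<^sub>R \<mu>"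
    \<comment> \<open>Subtracting the two equations gives a drift difference opposite to \<xi> -
      \<eta>, and monotonicity then leaves no room for a nonzero difference.\<close>
    then have "root_drift R k \<xi> - root_drift R k \<eta> = - (\<xi> - \<eta>)"
      by (simp add: algebra_simps)
    then have "(\<xi> - \<eta>) \<bullet> (\<xi> - \<eta>) \<le> 0"
      using root_drift_monotone[where R = R and k = k, OF R k, of \<xi> \<eta>]
      by (simp del: minus_diff_eq)
    then show "\<xi> = \<eta>" by (metis inner_gt_zero_iff not_le right_minus_eq)
  qed
  then show ?thesis
    unfolding master_extremum_def critical by (rule theI')
qed

section \<open>The invariant quadratic form of the weighted roots\<close>

text \<open>The form belongs to a symmetric operator \<open>T\<close> commuting with all root
  reflections. Every root is then an eigenvector, irreducibility forces a single eigenvalue, and the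
  trace gives its value.\<close>

lemma weighted_root_sum:
  fixes R :: "'a::euclidean_space set"
  assumes R: "root_system R" and irr: "irreducible_roots R" and m: "multiplicity_function R k"
  shows "(\<Sum>\<alpha>\<in>R. inverse (k \<alpha>) * (\<alpha> \<bullet> \<xi>)\<^sup>2 / (norm \<alpha>)\<^sup>2)
       = (\<Sum>\<alpha>\<in>R. inverse (k \<alpha>)) / real DIM('a) * (norm \<xi>)\<^sup>2"
proof -
  define T where "T x = (\<Sum>\<alpha>\<in>R. (inverse (k \<alpha>) * (\<alpha> \<bullet> x) / (norm \<alpha>)\<^sup>2) *\<^sub>R \<alpha>)" for x
  have nz: "\<alpha> \<noteq> 0" if "\<alpha> \<in> R" for \<alpha> using R that by (auto simp: root_system_def)
  have T_linear: "linear T"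
    unfolding T_def
    by (rule linearI) (simp_all add: inner_add_right sum.distrib scaleR_sum_right add_divide_distrib
        ring_distribs scaleR_left_distrib mult_ac)
  have T_sym: "T x \<bullet> y = x \<bullet> T y" for x y
    unfolding T_def by (simp add: inner_sum_left inner_sum_right inner_commute mult_ac)
  have T_reflection: "T (reflection \<beta> x) = reflection \<beta> (T x)" if "\<beta> \<in> R" for \<beta> x
  proof -
    have "T (reflection \<beta> x) = (\<Sum>\<alpha>\<in>R. (inverse (k (reflection \<beta> \<alpha>)) * (reflection \<beta> \<alpha> \<bullet> reflection \<beta> x)
        / (norm (reflection \<beta> \<alpha>))\<^sup>2) *\<^sub>R reflection \<beta> \<alpha>)"
      unfolding T_def by (rule sum_reflection[OF R that, symmetric])
    also have "\<dots> = (\<Sum>\<alpha>\<in>R. (inverse (k \<alpha>) * (\<alpha> \<bullet> x) / (norm \<alpha>)\<^sup>2) *\<^sub>R reflection \<beta> \<alpha>)"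
      using nz[OF that] multiplicity_reflection[OF m that]
      by (simp add: norm_reflection reflection_inner reflection_reflection)
    also have "\<dots> = reflection \<beta> (T x)"
      unfolding T_def by (simp add: linear_sum[OF reflection_linear] linear_scale[OF reflection_linear])
    finally show ?thesis .
  qed
  define c where "c \<beta> = coroot \<beta> (T \<beta>) / 2" for \<beta>
  have T_root: "T \<beta> = c \<beta> *\<^sub>R \<beta>" if "\<beta> \<in> R" for \<beta>
  proof -
    \<comment> \<open>\<open>T \<beta>\<close> lies in the (-1)-eigenspace of the reflection in
      \<beta>, which is the line through \<beta>.\<close>
    have "- T \<beta> = T (- \<beta>)" by (simp add: linear_neg[OF T_linear])
    also have "\<dots> = reflection \<beta> (T \<beta>)" using T_reflection[OF that] reflection_self[OF nz[OF that]] by metis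
    finally have "2 *\<^sub>R T \<beta> = coroot \<beta> (T \<beta>) *\<^sub>R \<beta>"
      by (simp add: reflection_def scaleR_2 algebra_simps)
    then have "(1 / 2) *\<^sub>R (2 *\<^sub>R T \<beta>) = (1 / 2) *\<^sub>R (coroot \<beta> (T \<beta>) *\<^sub>R \<beta>)" by simp
    then show ?thesis by (simp add: c_def)
  qed
  \<comment> \<open>Eigenvectors of a symmetric operator for different eigenvalues are
    orthogonal.\<close>
  have c_eq: "c \<alpha> = c \<beta>" if "\<alpha> \<in> R" "\<beta> \<in> R" "\<alpha> \<bullet> \<beta> \<noteq> 0" for \<alpha> \<beta>
    using T_sym[of \<alpha> \<beta>] that by (simp add: T_root)
  obtain \<alpha>0 where \<alpha>0: "\<alpha>0 \<in> R" using irr by (auto simp: irreducible_roots_def)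
  have c_const: "c \<beta> = c \<alpha>0" if "\<beta> \<in> R" for \<beta>
  proof (rule ccontr)
    assume "c \<beta> \<noteq> c \<alpha>0"
    \<comment> \<open>Roots with different eigenvalues are orthogonal, so this split would decompose
      the root system.\<close>
    define A B where "A = {\<alpha>\<in>R. c \<alpha> = c \<alpha>0}" and "B = {\<alpha>\<in>R. c \<alpha> \<noteq> c \<alpha>0}"
    have "A \<noteq> {}" "B \<noteq> {}" "A \<inter> B = {}" "A \<union> B = R" "\<forall>\<alpha>\<in>A. \<forall>\<beta>\<in>B. \<alpha> \<bullet> \<beta> = 0"
      using \<alpha>0 that \<open>c \<beta> \<noteq> c \<alpha>0\<close> c_eq unfolding A_def B_def by (auto, metis)
    then show False using irr unfolding irreducible_roots_def by blast
  qed
  have T_scalar: "T x = c \<alpha>0 *\<^sub>R x" for x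
  proof (rule linear_eq_on_span[OF T_linear])
    show "linear ((*\<^sub>R) (c \<alpha>0))" by simp
    show "T y = c \<alpha>0 *\<^sub>R y" if "y \<in> R" for y using T_root[OF that] c_const[OF that] by simp
    show "x \<in> span R" using R by (simp add: root_system_def)
  qed
  have form: "(\<Sum>\<alpha>\<in>R. inverse (k \<alpha>) * (\<alpha> \<bullet> x)\<^sup>2 / (norm \<alpha>)\<^sup>2) = T x \<bullet> x" for x
    unfolding T_def by (simp add: inner_sum_left power2_eq_square mult_ac)
  \<comment> \<open>Both sides are the trace of \<open>T\<close>: each \<alpha> contributes
    \<open>inverse (k \<alpha>)\<close> times the orthogonal projection onto its line, which has
    trace 1.\<close>
  have "(\<Sum>\<alpha>\<in>R. inverse (k \<alpha>)) = (\<Sum>\<alpha>\<in>R. \<Sum>b\<in>Basis. inverse (k \<alpha>) * (\<alpha> \<bullet> b)\<^sup>2 / (norm \<alpha>)\<^sup>2)"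
  proof (rule sum.cong[OF HOL.refl])
    fix \<alpha> assume "\<alpha> \<in> R"
    have "(\<Sum>b\<in>Basis. (\<alpha> \<bullet> b)\<^sup>2) = (norm \<alpha>)\<^sup>2"
      unfolding power2_norm_eq_inner euclidean_inner[of \<alpha> \<alpha>] by (simp add: power2_eq_square)
    then show "inverse (k \<alpha>) = (\<Sum>b\<in>Basis. inverse (k \<alpha>) * (\<alpha> \<bullet> b)\<^sup>2 / (norm \<alpha>)\<^sup>2)"
      using nz[OF \<open>\<alpha> \<in> R\<close>] by (simp flip: sum_distrib_left sum_divide_distrib)
  qed
  also have "\<dots> = (\<Sum>b\<in>(Basis::'a set). T b \<bullet> b)"
    by (subst sum.swap) (simp add: form)
  also have "\<dots> = c \<alpha>0 * real DIM('a)"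
    by (simp add: T_scalar)
  finally show ?thesis
    unfolding form by (simp add: T_scalar power2_norm_eq_inner)
qed

section \<open>Bounds for the drift along a root\<close>

text \<open>The sum is added to its reindexing by the reflection in \<beta>. That reflection flips
  the sign of \<open>coroot \<beta> \<alpha>\<close> and preserves \<open>k \<alpha>\<close>, so
  increments of arctan appear.\<close>

lemma coroot_root_drift_symmetrized:
  assumes R: "root_system R" and m: "multiplicity_function R k" and b: "\<beta> \<in> R"
  shows "2 * coroot \<beta> (root_drift R k \<xi>) = (\<Sum>\<alpha>\<in>R. coroot \<beta> \<alpha> *
     (arctan (coroot \<alpha> \<xi> / k \<alpha>) - arctan ((coroot \<alpha> \<xi> - coroot \<beta> \<xi> * coroot \<alpha> \<beta>) / k \<alpha>)))"
proof -
  have nz: "\<beta> \<noteq> 0" using R b by (auto simp: root_system_def)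
  have 1: "coroot \<beta> (root_drift R k \<xi>) = (\<Sum>\<alpha>\<in>R. arctan (coroot \<alpha> \<xi> / k \<alpha>) * coroot \<beta> \<alpha>)"
    by (simp add: root_drift_def coroot_sum coroot_scale)
  also have "\<dots> = (\<Sum>\<alpha>\<in>R. arctan (coroot (reflection \<beta> \<alpha>) \<xi> / k (reflection \<beta> \<alpha>)) * coroot \<beta> (reflection \<beta> \<alpha>))"
    by (rule sum_reflection[OF R b, symmetric])
  also have "\<dots> = (\<Sum>\<alpha>\<in>R. - arctan ((coroot \<alpha> \<xi> - coroot \<beta> \<xi> * coroot \<alpha> \<beta>) / k \<alpha>) * coroot \<beta> \<alpha>)"
  proof (rule sum.cong[OF HOL.refl])
    fix \<alpha> assume "\<alpha> \<in> R"
    have "coroot (reflection \<beta> \<alpha>) \<xi> = coroot \<alpha> \<xi> - coroot \<beta> \<xi> * coroot \<alpha> \<beta>"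
      unfolding coroot_reflection_root[OF nz] by (simp add: reflection_def coroot_diff coroot_scale)
    then show "arctan (coroot (reflection \<beta> \<alpha>) \<xi> / k (reflection \<beta> \<alpha>)) * coroot \<beta> (reflection \<beta> \<alpha>) =
        - arctan ((coroot \<alpha> \<xi> - coroot \<beta> \<xi> * coroot \<alpha> \<beta>) / k \<alpha>) * coroot \<beta> \<alpha>"
      using multiplicity_reflection[OF m b \<open>\<alpha> \<in> R\<close>] by (simp add: coroot_reflection[OF nz])
  qed
  finally show ?thesis
    using 1 by (simp add: right_diff_distrib sum_subtractf mult.commute sum_negf)
qed

lemma coroot_root_drift_bounds:
  fixes R :: "'a::euclidean_space set"
  assumes R: "root_system R" and irr: "irreducible_roots R" and m: "multiplicity_function R k"
    and b: "\<beta> \<in> R" and x: "0 \<le> coroot \<beta> \<xi>"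
  shows "0 \<le> coroot \<beta> (root_drift R k \<xi>)"
    and "coroot \<beta> (root_drift R k \<xi>) \<le> h_const R k / real DIM('a) * coroot \<beta> \<xi>"
proof -
  define d where "d \<alpha> = arctan (coroot \<alpha> \<xi> / k \<alpha>)
     - arctan ((coroot \<alpha> \<xi> - coroot \<beta> \<xi> * coroot \<alpha> \<beta>) / k \<alpha>)" for \<alpha>
  have nz: "\<alpha> \<noteq> 0" if "\<alpha> \<in> R" for \<alpha> using R that by (auto simp: root_system_def)
  have term_bounds: "0 \<le> coroot \<beta> \<alpha> * d \<alpha> \<and>
      coroot \<beta> \<alpha> * d \<alpha> \<le> coroot \<beta> \<alpha> * (coroot \<beta> \<xi> * coroot \<alpha> \<beta> / k \<alpha>)" if a: "\<alpha> \<in> R" for \<alpha>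
  proof -
    have k: "k \<alpha> > 0" using m a by (auto simp: multiplicity_function_def)
    \<comment> \<open>Both numbers have the sign of \<alpha> \<bullet> \<beta>. When it is negative,
      the bounds on \<open>d \<alpha>\<close> are reversed, and the multiplication by
      \<open>coroot \<beta> \<alpha>\<close> reverses them back.\<close>
    have sgn: "0 \<le> coroot \<beta> \<alpha> \<longleftrightarrow> 0 \<le> coroot \<alpha> \<beta>"
      using nz[OF a] nz[OF b]
      by (simp add: coroot_def zero_le_divide_iff inner_commute zero_le_mult_iff)
    define u v where "u = coroot \<alpha> \<xi> / k \<alpha>" and "v = (coroot \<alpha> \<xi> - coroot \<beta> \<xi> * coroot \<alpha> \<beta>) / k \<alpha>"
    have uv: "u - v = coroot \<beta> \<xi> * coroot \<alpha> \<beta> / k \<alpha>"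
      by (simp add: u_def v_def diff_divide_distrib)
    have d: "d \<alpha> = arctan u - arctan v" by (simp add: d_def u_def v_def)
    show ?thesis
    proof (cases "0 \<le> coroot \<alpha> \<beta>")
      case True
      then have "0 \<le> u - v" unfolding uv using x k by simp
      then have "0 \<le> d \<alpha>" "d \<alpha> \<le> u - v"
        using arctan_diff_le[of v u] by (simp_all add: d arctan_le_iff)
      then show ?thesis
        using True sgn unfolding uv by (intro conjI mult_nonneg_nonneg mult_left_mono) simp_all
    next
      case False
      then have "u - v \<le> 0" unfolding uv using x k by (simp add: divide_le_0_iff mult_le_0_iff)
      then have "d \<alpha> \<le> 0" "u - v \<le> d \<alpha>"
        using arctan_diff_le[of u v] by (simp_all add: d arctan_le_iff)
      then show ?thesis
        using False sgn unfolding uv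
        by (intro conjI mult_nonpos_nonpos mult_left_mono_neg) simp_all
    qed
  qed
  have drift: "2 * coroot \<beta> (root_drift R k \<xi>) = (\<Sum>\<alpha>\<in>R. coroot \<beta> \<alpha> * d \<alpha>)"
    unfolding d_def by (rule coroot_root_drift_symmetrized[OF R m b])
  have "0 \<le> (\<Sum>\<alpha>\<in>R. coroot \<beta> \<alpha> * d \<alpha>)"
    using term_bounds by (intro sum_nonneg) auto
  with drift show "0 \<le> coroot \<beta> (root_drift R k \<xi>)" by simp
  have "(\<Sum>\<alpha>\<in>R. coroot \<beta> \<alpha> * d \<alpha>) \<le> (\<Sum>\<alpha>\<in>R. coroot \<beta> \<alpha> * (coroot \<beta> \<xi> * coroot \<alpha> \<beta> / k \<alpha>))"
    using term_bounds by (intro sum_mono) auto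
  \<comment> \<open>The product of the two mixed co-root values is 4 cos^2 of the angle between
    \<alpha> and \<beta>, which produces the invariant form at \<beta>.\<close>
  also have "\<dots> = (\<Sum>\<alpha>\<in>R. 4 * coroot \<beta> \<xi> / (norm \<beta>)\<^sup>2 * (inverse (k \<alpha>) * (\<alpha> \<bullet> \<beta>)\<^sup>2 / (norm \<alpha>)\<^sup>2))"
  proof (rule sum.cong[OF HOL.refl])
    fix \<alpha>
    have "coroot \<beta> \<alpha> * coroot \<alpha> \<beta> = 4 / (norm \<beta>)\<^sup>2 * ((\<alpha> \<bullet> \<beta>)\<^sup>2 / (norm \<alpha>)\<^sup>2)"
      by (simp add: coroot_def inner_commute power2_eq_square)
    then have "coroot \<beta> \<xi> * inverse (k \<alpha>) * (coroot \<beta> \<alpha> * coroot \<alpha> \<beta>) =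
        coroot \<beta> \<xi> * inverse (k \<alpha>) * (4 / (norm \<beta>)\<^sup>2 * ((\<alpha> \<bullet> \<beta>)\<^sup>2 / (norm \<alpha>)\<^sup>2))" by simp
    then show "coroot \<beta> \<alpha> * (coroot \<beta> \<xi> * coroot \<alpha> \<beta> / k \<alpha>) =
        4 * coroot \<beta> \<xi> / (norm \<beta>)\<^sup>2 * (inverse (k \<alpha>) * (\<alpha> \<bullet> \<beta>)\<^sup>2 / (norm \<alpha>)\<^sup>2)"
      by (simp add: divide_inverse mult_ac)
  qed
  \<comment> \<open>The form at \<beta> cancels \<open>(norm \<beta>)\<^sup>2\<close>. Of the factor
    4, one 2 is absorbed by \<open>h_const\<close> and the other matches the doubled left side of
    \<open>drift\<close>.\<close>
  also have "\<dots> = 2 * (h_const R k / real DIM('a) * coroot \<beta> \<xi>)"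
    unfolding sum_distrib_left[symmetric] weighted_root_sum[OF R irr m]
    using nz[OF b] by (simp add: h_const_def)
  finally show "coroot \<beta> (root_drift R k \<xi>) \<le> h_const R k / real DIM('a) * coroot \<beta> \<xi>"
    using drift by simp
qed

section \<open>Transfer to the extremum\<close>

text \<open>Evaluating the critical equation at the co-root of \<beta> turns the two bounds on the
  drift into these.\<close>

lemma coroot_master_extremum_bounds:
  fixes R :: "'a::euclidean_space set"
  assumes "root_system R" "irreducible_roots R" "multiplicity_function R k" "\<beta> \<in> R"
    and x: "0 \<le> coroot \<beta> (master_extremum R k \<mu>)"
  shows "coroot \<beta> (master_extremum R k \<mu>) \<le> 2 * pi * coroot \<beta> \<mu>"
    and "2 * pi * coroot \<beta> \<mu> \<le> (1 + h_const R k / real DIM('a)) * coroot \<beta> (master_extremum R k \<mu>)"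
proof -
  have "coroot \<beta> (master_extremum R k \<mu> + root_drift R k (master_extremum R k \<mu>)) = 2 * pi * coroot \<beta> \<mu>"
    using assms by (subst master_extremum_eq) (auto simp: multiplicity_function_def coroot_scale)
  then show "coroot \<beta> (master_extremum R k \<mu>) \<le> 2 * pi * coroot \<beta> \<mu>"
    "2 * pi * coroot \<beta> \<mu> \<le> (1 + h_const R k / real DIM('a)) * coroot \<beta> (master_extremum R k \<mu>)"
    using coroot_root_drift_bounds[OF assms] by (simp_all add: coroot_add distrib_right)
qed

text \<open>Passing from \<mu> to its extremum preserves nonnegativity on each co-root separately,
  which gives both the sign hypothesis of the bounds and the characterization of dominance.\<close>

lemma coroot_master_extremum_nonneg_iff:
  assumes "root_system R" "irreducible_roots R" "multiplicity_function R k" "\<beta> \<in> R"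
  shows "0 \<le> coroot \<beta> (master_extremum R k \<mu>) \<longleftrightarrow> 0 \<le> coroot \<beta> \<mu>"
proof
  assume "0 \<le> coroot \<beta> (master_extremum R k \<mu>)"
  with coroot_master_extremum_bounds(1)[OF assms this] have "0 \<le> 2 * pi * coroot \<beta> \<mu>" by linarith
  then show "0 \<le> coroot \<beta> \<mu>"
    using mult_le_cancel_left_pos[of "2 * pi" 0 "coroot \<beta> \<mu>"] by simp
next
  assume le: "0 \<le> coroot \<beta> \<mu>"
  show "0 \<le> coroot \<beta> (master_extremum R k \<mu>)"
  proof (rule ccontr)
    assume neg: "\<not> 0 \<le> coroot \<beta> (master_extremum R k \<mu>)"
    \<comment> \<open>The upper bound is applied to the opposite root, on whose co-root the extremum
      is positive.\<close>
    then have "coroot (- \<beta>) (master_extremum R k \<mu>) \<le> 2 * pi * coroot (- \<beta>) \<mu>"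
      using assms uminus_root[of R \<beta>]
      by (intro coroot_master_extremum_bounds) (auto simp: coroot_minus_root)
    with neg have "2 * pi * coroot \<beta> \<mu> < 0" by (simp add: coroot_minus_root)
    with le show False by (simp add: mult_less_0_iff)
  qed
qed

section \<open>The closed fundamental chamber\<close>

text \<open>The witness has inner product 1 with every simple root; its inner product with a
  positive root is then the height of that root.\<close>

lemma fundamental_chamber_nonempty:
  fixes R :: "'a::euclidean_space set"
  assumes R: "root_system R" and D: "root_basis R \<Delta>"
  obtains \<zeta> where "\<zeta> \<in> fundamental_chamber R \<Delta>"
proof -
  have "independent \<Delta>" using D by (simp add: root_basis_def)
  then obtain f :: "'a \<Rightarrow> real" where f: "linear f" "\<And>\<alpha>. \<alpha> \<in> \<Delta> \<Longrightarrow> f \<alpha> = 1"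
    using linear_independent_extend[of \<Delta> "\<lambda>_. 1"] by auto
  \<comment> \<open>The vector representing the functional \<open>f\<close> by the inner
    product.\<close>
  define \<zeta> where "\<zeta> = adjoint f 1"
  have \<zeta>: "\<zeta> \<bullet> x = f x" for x
    using adjoint_works[OF f(1), of x 1] by (simp add: \<zeta>_def inner_commute)
  have "coroot \<beta> \<zeta> > 0" if pos: "\<beta> \<in> positive_roots R \<Delta>" for \<beta>
  proof -
    obtain c :: "'a \<Rightarrow> nat" where c: "\<beta> = (\<Sum>\<alpha>\<in>\<Delta>. of_nat (c \<alpha>) *\<^sub>R \<alpha>)" and "\<beta> \<in> R"
      using pos by (auto simp: positive_roots_def)
    then have nz: "\<beta> \<noteq> 0" using R by (auto simp: root_system_def)
    have "\<zeta> \<bullet> \<beta> = (\<Sum>\<alpha>\<in>\<Delta>. real (c \<alpha>))"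
      unfolding \<zeta> c by (simp add: linear_sum[OF f(1)] linear_scale[OF f(1)] f(2))
    moreover have "(\<Sum>\<alpha>\<in>\<Delta>. real (c \<alpha>)) \<noteq> 0"
    proof
      assume "(\<Sum>\<alpha>\<in>\<Delta>. real (c \<alpha>)) = 0"
      moreover have "finite \<Delta>" using \<open>independent \<Delta>\<close> independent_imp_finite by blast
      ultimately have "\<forall>\<alpha>\<in>\<Delta>. c \<alpha> = 0" by (simp add: sum_nonneg_eq_0_iff)
      with nz c show False by simp
    qed
    ultimately have "\<zeta> \<bullet> \<beta> > 0" by (simp add: order.not_eq_order_implies_strict sum_nonneg)
    with nz show ?thesis by (simp add: coroot_def)
  qed
  then show ?thesis using that[of \<zeta>] by (simp add: fundamental_chamber_def)
qed

text \<open>The weak inequalities define a closed set. Conversely, adding ever smaller positive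
  multiples of a chamber point makes them strict, so each of its points is a limit from the
  chamber.\<close>

lemma closure_fundamental_chamber:
  fixes R :: "'a::euclidean_space set"
  assumes "root_system R" "root_basis R \<Delta>"
  shows "closure (fundamental_chamber R \<Delta>) = {\<xi>. \<forall>\<beta>\<in>positive_roots R \<Delta>. 0 \<le> coroot \<beta> \<xi>}"
    (is "_ = ?C")
proof
  have "closed ?C"
    unfolding Collect_ball_eq
    by (intro closed_INT ballI closed_Collect_le continuous_intros)
  then show "closure (fundamental_chamber R \<Delta>) \<subseteq> ?C"
    by (intro closure_minimal) (auto simp: fundamental_chamber_def less_imp_le)
next
  obtain \<zeta> where \<zeta>: "\<zeta> \<in> fundamental_chamber R \<Delta>"
    using fundamental_chamber_nonempty[OF assms] .
  show "?C \<subseteq> closure (fundamental_chamber R \<Delta>)"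
  proof
    fix \<xi> assume "\<xi> \<in> ?C"
    then have "\<forall>i. \<xi> + inverse (real (Suc i)) *\<^sub>R \<zeta> \<in> fundamental_chamber R \<Delta>"
      using \<zeta> by (auto simp: fundamental_chamber_def coroot_add coroot_scale intro!: add_nonneg_pos)
    moreover have "(\<lambda>i. \<xi> + inverse (real (Suc i)) *\<^sub>R \<zeta>) \<longlonglongrightarrow> \<xi> + 0 *\<^sub>R \<zeta>"
      by (intro tendsto_intros LIMSEQ_inverse_real_of_nat)
    ultimately show "\<xi> \<in> closure (fundamental_chamber R \<Delta>)"
      unfolding closure_sequential by auto
  qed
qed

theorem proposition2p10:
  fixes R \<Delta> :: "'a::euclidean_space set" and k :: "'a \<Rightarrow> real"
  assumes "root_system R" and "crystallographic R" and "reduced_roots R" and "irreducible_roots R"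
    and "root_basis R \<Delta>"
    and "multiplicity_function R k"
  shows "(\<forall>\<mu>\<in>dominant_weights R \<Delta>. \<forall>\<beta>\<in>positive_roots R \<Delta>.
            2 * pi * coroot \<beta> \<mu> / (1 + h_const R k / real DIM('a)) \<le> coroot \<beta> (master_extremum R k \<mu>)
          \<and> coroot \<beta> (master_extremum R k \<mu>) \<le> 2 * pi * coroot \<beta> \<mu>)
       \<and> (\<forall>\<mu>\<in>weight_lattice R.
            \<mu> \<in> dominant_weights R \<Delta> \<longleftrightarrow> master_extremum R k \<mu> \<in> closure (fundamental_chamber R \<Delta>))"
proof (intro conjI ballI)
  note assms' = assms(1,4,6)
  have root: "\<beta> \<in> R" if "\<beta> \<in> positive_roots R \<Delta>" for \<beta>
    using that by (simp add: positive_roots_def)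
  have "h_const R k \<ge> 0"
    using assms(6) by (auto simp: h_const_def multiplicity_function_def less_imp_le intro!: sum_nonneg)
  then have h: "1 + h_const R k / real DIM('a) > 0"
    by (intro add_pos_nonneg) auto
  fix \<mu> \<beta>
  assume \<mu>: "\<mu> \<in> dominant_weights R \<Delta>" and \<beta>: "\<beta> \<in> positive_roots R \<Delta>"
  have nonneg: "0 \<le> coroot \<beta> (master_extremum R k \<mu>)"
    using \<mu> \<beta> coroot_master_extremum_nonneg_iff[OF assms' root[OF \<beta>]]
    by (auto simp: dominant_weights_def)
  note bounds = coroot_master_extremum_bounds[OF assms' root[OF \<beta>] nonneg]
  show "coroot \<beta> (master_extremum R k \<mu>) \<le> 2 * pi * coroot \<beta> \<mu>"
    by (rule bounds)
  show "2 * pi * coroot \<beta> \<mu> / (1 + h_const R k / real DIM('a)) \<le> coroot \<beta> (master_extremum R k \<mu>)"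
    using bounds(2) h by (simp add: pos_divide_le_eq mult.commute)
next
  fix \<mu> assume "\<mu> \<in> weight_lattice R"
  then show "\<mu> \<in> dominant_weights R \<Delta> \<longleftrightarrow> master_extremum R k \<mu> \<in> closure (fundamental_chamber R \<Delta>)"
    \<comment> \<open>Both sides are now sign conditions over the same positive roots, equivalent
      root by root.\<close>
    unfolding closure_fundamental_chamber[OF assms(1,5)]
    using coroot_master_extremum_nonneg_iff[OF assms(1,4,6)]
    by (auto simp: dominant_weights_def positive_roots_def)
qed

end
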